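(* As formal power series in $q$, $$\sum_{n\geq 0}\widetilde G_n(a,b,c,d;t)q^n=\frac{t^{-1}+(d-c)q+(b-a)q^2-\sqrt{t^{-2}-2t^{-1}(c+d)q+((c+d)^2-2t^{-1}(a+b))q^2+2(a-b)(c-d)q^3+(a-b)^2q^4}}{2q},$$ where the square root is the power series in $q$ with constant term $t^{-1}$.
   Context: A plane tree is an unlabeled rooted tree in which the children of every vertex are linearly ordered; $\mathcal P_n$ is the set of plane trees with $n$ edges. A leaf is a vertex with no children, an interior vertex one with at least one child. A leaf without siblings is a singleton leaf; a leaf with siblings is an elder leaf if it is the leftmost child of its parent, and a young leaf otherwise; an interior vertex is a young interior vertex if it is not the parent of a singleton leaf or of an elder leaf. An edge is a young edge if its lower endpoint (the child) is neither a singleton leaf nor an elder leaf. For $T\in\mathcal P_n$, $\mathrm{sleaf},\mathrm{eleaf},\mathrm{yleaf},\mathrm{yint},\mathrm{yedge}$ count singleton leaves, elder leaves, young leaves, young interior vertices and young edges. For $n\ge2$, $\widetilde G_n(a,b,c,d;t)=\sum_{T\in\mathcal P_n}a^{\mathrm{sleaf}(T)}b^{\mathrm{eleaf}(T)}c^{\mathrm{yleaf}(T)}d^{\mathrm{yint}(T)}t^{\mathrm{yedge}(T)}$, and by convention $\widetilde G_0=d$, $\widetilde G_1=b$. *)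

theory Defs
  imports "HOL-Computational_Algebra.Formal_Power_Series"
begin

section \<open>Plane trees and their vertices\<close>

datatype ptree = Node (subtrees: "ptree list")

text \<open>A vertex is encoded by its address: \<open>[]\<close> is the root, and \<open>u @ [i]\<close> is the
  \<open>i\<close>-th child of \<open>u\<close>, counted from the left starting with 0.\<close>

primrec subtree_at :: "nat list \<Rightarrow> ptree \<Rightarrow> ptree option" where
  "subtree_at [] T = Some T"
| "subtree_at (i # p) T =
     (if i < length (subtrees T) then subtree_at p (subtrees T ! i) else None)"

definition vertices :: "ptree \<Rightarrow> nat list set" where
  "vertices T = {v. subtree_at v T \<noteq> None}"

definition child :: "ptree \<Rightarrow> nat list \<Rightarrow> nat list \<Rightarrow> bool" where
  "child T u v \<longleftrightarrow> v \<in> vertices T \<and> (\<exists>i. v = u @ [i])"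

definition edges :: "ptree \<Rightarrow> (nat list \<times> nat list) set" where
  "edges T = {(u, v). child T u v}"

definition plane_trees :: "nat \<Rightarrow> ptree set" where
  "plane_trees n = {T. card (edges T) = n}"

section \<open>Leaves, interior vertices and young edges\<close>

definition leaf :: "ptree \<Rightarrow> nat list \<Rightarrow> bool" where
  "leaf T v \<longleftrightarrow> v \<in> vertices T \<and> \<not> (\<exists>w. child T v w)"

definition interior_vertex :: "ptree \<Rightarrow> nat list \<Rightarrow> bool" where
  "interior_vertex T v \<longleftrightarrow> v \<in> vertices T \<and> (\<exists>w. child T v w)"

definition siblings :: "ptree \<Rightarrow> nat list \<Rightarrow> nat list set" where
  "siblings T v = {w. w \<noteq> v \<and> (\<exists>u. child T u v \<and> child T u w)}"

definition leftmost_child :: "ptree \<Rightarrow> nat list \<Rightarrow> bool" where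
  "leftmost_child T v \<longleftrightarrow> (\<exists>u. child T u v \<and> v = u @ [0])"

definition singleton_leaf :: "ptree \<Rightarrow> nat list \<Rightarrow> bool" where
  "singleton_leaf T v \<longleftrightarrow> leaf T v \<and> siblings T v = {}"

definition elder_leaf :: "ptree \<Rightarrow> nat list \<Rightarrow> bool" where
  "elder_leaf T v \<longleftrightarrow> leaf T v \<and> siblings T v \<noteq> {} \<and> leftmost_child T v"

definition young_leaf :: "ptree \<Rightarrow> nat list \<Rightarrow> bool" where
  "young_leaf T v \<longleftrightarrow> leaf T v \<and> siblings T v \<noteq> {} \<and> \<not> leftmost_child T v"

definition young_interior :: "ptree \<Rightarrow> nat list \<Rightarrow> bool" where
  "young_interior T v \<longleftrightarrow> interior_vertex T v \<and>
     \<not> (\<exists>w. child T v w \<and> (singleton_leaf T w \<or> elder_leaf T w))"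

definition sleaf :: "ptree \<Rightarrow> nat" where "sleaf T = card {v. singleton_leaf T v}"
definition eleaf :: "ptree \<Rightarrow> nat" where "eleaf T = card {v. elder_leaf T v}"
definition yleaf :: "ptree \<Rightarrow> nat" where "yleaf T = card {v. young_leaf T v}"
definition yint  :: "ptree \<Rightarrow> nat" where "yint T = card {v. young_interior T v}"

definition yedge :: "ptree \<Rightarrow> nat" where
  "yedge T = card {(u, v). (u, v) \<in> edges T \<and> \<not> singleton_leaf T v \<and> \<not> elder_leaf T v}"

section \<open>The polynomials and the power series square root\<close>

text \<open>The values at \<open>n = 0\<close> and \<open>n = 1\<close> are conventions and are not given by the sum.\<close>

definition G_tilde ::
  "nat \<Rightarrow> 'a::comm_semiring_1 \<Rightarrow> 'a \<Rightarrow> 'a \<Rightarrow> 'a \<Rightarrow> 'a \<Rightarrow> 'a" where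
  "G_tilde n a b c d t =
     (if n = 0 then d else if n = 1 then b
      else \<Sum>T\<in>plane_trees n. a ^ sleaf T * b ^ eleaf T * c ^ yleaf T * d ^ yint T * t ^ yedge T)"

text \<open>The square root with prescribed constant term \<open>s\<close>; it exists and is unique
  whenever \<open>s \<noteq> 0\<close> and \<open>s\<close> squares to the constant term of \<open>D\<close>, see
  \<open>fps_sqrt_with_ex1\<close> below.\<close>

definition fps_sqrt_with :: "'a::field_char_0 \<Rightarrow> 'a fps \<Rightarrow> 'a fps" where
  "fps_sqrt_with s D = (THE S. S ^ 2 = D \<and> fps_nth S 0 = s)"

lemma fps_sqrt_with_ex1:
  fixes s :: "'a::field_char_0"
  assumes "s \<noteq> 0" and "fps_nth D 0 = s ^ 2"
  shows "\<exists>!S. S ^ 2 = D \<and> fps_nth S 0 = s"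
proof (rule ex_ex1I)
  let ?R = "fps_radical (\<lambda>_ _. s) (Suc 1) D"
  have "?R ^ Suc 1 = D"
    by (rule iffD1[OF power_radical]) (use assms in \<open>auto simp: power2_eq_square\<close>)
  moreover have "fps_nth ?R 0 = s"
    by simp
  ultimately show "\<exists>S. S ^ 2 = D \<and> fps_nth S 0 = s"
    by (auto simp: numeral_2_eq_2)
next
  fix S R :: "'a fps"
  assume S: "S ^ 2 = D \<and> fps_nth S 0 = s" and R: "R ^ 2 = D \<and> fps_nth R 0 = s"
  have "fps_nth (S + R) 0 \<noteq> 0"
    using S R assms(1) by (simp flip: mult_2)
  hence "S + R \<noteq> 0" by fastforce
  moreover have "S = R \<or> S = - R"
    using S R by (metis power2_eq_iff)
  ultimately show "S = R" by auto
qed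

lemma fps_sqrt_with:
  fixes s :: "'a::field_char_0"
  assumes "s \<noteq> 0" and "fps_nth D 0 = s ^ 2"
  shows "fps_sqrt_with s D ^ 2 = D" and "fps_nth (fps_sqrt_with s D) 0 = s"
  using theI'[OF fps_sqrt_with_ex1[OF assms]] unfolding fps_sqrt_with_def by auto

section \<open>The sums are finite\<close>

lemma vertices_Node:
  "vertices (Node ts) = insert [] (\<Union>i<length ts. (#) i ` vertices (ts ! i))"
proof (rule set_eqI)
  fix v show "v \<in> vertices (Node ts) \<longleftrightarrow> v \<in> insert [] (\<Union>i<length ts. (#) i ` vertices (ts ! i))"
    by (cases v) (auto simp: vertices_def)
qed

lemma Nil_in_vertices [simp]: "[] \<in> vertices T"
  by (simp add: vertices_def)

lemma finite_vertices: "finite (vertices T)"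
proof (induction T)
  case (Node ts)
  thus ?case by (auto simp: vertices_Node)
qed

lemma card_vertices: "card (vertices T) = Suc (card (edges T))"
proof -
  have inj: "inj_on snd (edges T)"
    by (rule inj_onI) (auto simp: edges_def child_def)
  have "snd ` edges T = vertices T - {[]}"
  proof (rule set_eqI)
    fix v
    show "v \<in> snd ` edges T \<longleftrightarrow> v \<in> vertices T - {[]}"
      by (cases v rule: rev_cases) (auto simp: edges_def child_def image_iff)
  qed
  with inj have "bij_betw snd (edges T) (vertices T - {[]})"
    by (rule bij_betw_imageI)
  hence "card (edges T) = card (vertices T - {[]})"
    by (rule bij_betw_same_card)
  moreover have "card (vertices T) = Suc (card (vertices T - {[]}))"
    by (rule card.remove[OF finite_vertices Nil_in_vertices])
  ultimately show ?thesis by (simp only:)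
qed

lemma finite_card_vertices_le: "finite {T. card (vertices T) \<le> n}"
proof (induction n)
  case 0
  show ?case by (simp add: card_vertices)
next
  case (Suc n)
  let ?A = "{T. card (vertices T) \<le> n}"
  have "{T. card (vertices T) \<le> Suc n} \<subseteq> Node ` {ts. set ts \<subseteq> ?A \<and> length ts \<le> n}"
  proof
    fix T assume "T \<in> {T. card (vertices T) \<le> Suc n}"
    moreover obtain ts where T: "T = Node ts" by (cases T)
    ultimately have le: "card (vertices (Node ts)) \<le> Suc n" by simp
    let ?U = "\<Union>i<length ts. (#) i ` vertices (ts ! i)"
    have fin: "finite ?U" by (auto simp: finite_vertices)
    have "card (vertices (Node ts)) = Suc (card ?U)"
      unfolding vertices_Node by (rule card_insert_disjoint) (use fin in auto)
    with le have U: "card ?U \<le> n" by simp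
    have "card ((\<lambda>i. [i]) ` {..<length ts}) \<le> card ?U"
      by (rule card_mono[OF fin]) auto
    moreover have "card ((\<lambda>i. [i]) ` {..<length ts}) = length ts"
      by (subst card_image) (auto simp: inj_on_def)
    ultimately have "length ts \<le> n" using U by simp
    moreover have "card (vertices (ts ! i)) \<le> n" if "i < length ts" for i
    proof -
      have "card ((#) i ` vertices (ts ! i)) \<le> card ?U"
        by (rule card_mono[OF fin]) (use that in auto)
      moreover have "card ((#) i ` vertices (ts ! i)) = card (vertices (ts ! i))"
        by (rule card_image) simp
      ultimately show ?thesis using U by simp
    qed
    hence "set ts \<subseteq> ?A" by (auto simp: set_conv_nth)
    ultimately show "T \<in> Node ` {ts. set ts \<subseteq> ?A \<and> length ts \<le> n}"
      using T by auto
  qed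
  moreover have "finite {ts. set ts \<subseteq> ?A \<and> length ts \<le> n}"
    by (rule finite_lists_length_le[OF Suc])
  ultimately show ?case by (meson finite_imageI finite_subset)
qed

lemma finite_plane_trees: "finite (plane_trees n)"
  by (rule finite_subset[OF _ finite_card_vertices_le[of "Suc n"]])
     (auto simp: plane_trees_def card_vertices)

end

theory Submission imports Defs begin

text \<open>Removing the last child \<open>S\<close> of the root splits a tree \<open>Node (ts @ [S])\<close> into \<open>Node ts\<close> and
  \<open>S\<close>. With the conventional weights \<open>d\<close> and \<open>b\<close> for the trees with zero and one edge, the weight
  of the tree is the product of the weights of \<open>Node ts\<close> and of \<open>S\<close>, the latter multiplied by \<open>t\<close>
  and corrected to \<open>c\<close> and \<open>a\<close> when \<open>S\<close> has zero or one edge; the only exception is the tree with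
  one edge. Hence the generating function satisfies
  \<open>F = d + (b - d t c) q + q F t (F + (c - d) + (a - b) q)\<close>,
  and completing the square exhibits \<open>t\<^sup>-\<^sup>1 + (d - c) q + (b - a) q\<^sup>2 - 2 q F\<close> as
  the required square root.\<close>

section \<open>Local characterisation of the vertex types\<close>

lemma subtree_at_append:
  "subtree_at (u @ p) T = Option.bind (subtree_at u T) (subtree_at p)"
  by (induction u arbitrary: T) auto

lemma child_iff:
  "child T u v \<longleftrightarrow> (\<exists>S i. subtree_at u T = Some S \<and> i < length (subtrees S) \<and> v = u @ [i])"
  by (cases "subtree_at u T") (auto simp: child_def vertices_def subtree_at_append split: if_splits)

lemma leaf_iff: "leaf T v \<longleftrightarrow> subtree_at v T = Some (Node [])"
proof (cases "subtree_at v T")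
  case (Some S)
  then show ?thesis by (cases S) (auto simp: leaf_def child_iff vertices_def)
qed (auto simp: leaf_def vertices_def)

text \<open>The siblings are the addresses \<open>u @ [j]\<close> with \<open>j\<close> another
  child index, so being an only child depends only on the number of children of the parent.\<close>

lemma siblings_empty_iff:
  assumes "subtree_at u T = Some S" "i < length (subtrees S)"
  shows "siblings T (u @ [i]) = {} \<longleftrightarrow> length (subtrees S) = 1"
proof -
  have eq: "siblings T (u @ [i]) = (\<lambda>j. u @ [j]) ` ({..<length (subtrees S)} - {i})"
    using assms by (auto simp: siblings_def child_iff)
  have "{..<length (subtrees S)} - {i} = {} \<longleftrightarrow> length (subtrees S) = 1"
  proof
    assume "{..<length (subtrees S)} - {i} = {}"
    hence "{..<length (subtrees S)} = {i}" using assms(2) by auto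
    thus "length (subtrees S) = 1" by (metis card_lessThan card_1_singleton_iff One_nat_def)
  next
    assume "length (subtrees S) = 1"
    thus "{..<length (subtrees S)} - {i} = {}" using assms(2) by auto
  qed
  thus ?thesis unfolding eq by simp
qed

text \<open>A root has no siblings, so the single vertex counts as a singleton leaf. This type can
  change once the tree is attached below a parent.\<close>

lemma singleton_leaf_Nil_iff: "singleton_leaf T [] \<longleftrightarrow> T = Node []"
  by (auto simp: singleton_leaf_def leaf_iff siblings_def child_iff)

lemma not_elder_leaf_Nil: "\<not> elder_leaf T []"
  by (auto simp: elder_leaf_def leftmost_child_def)

lemma not_young_leaf_Nil: "\<not> young_leaf T []"
  by (auto simp: young_leaf_def siblings_def child_iff)

lemma leaf_snoc_iff:
  "leaf T (u @ [i]) \<longleftrightarrow> (\<exists>S. subtree_at u T = Some S \<and> i < length (subtrees S) \<and> subtrees S ! i = Node [])"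
  by (cases "subtree_at u T") (auto simp: leaf_iff subtree_at_append)

lemma singleton_leaf_snoc_iff:
  "singleton_leaf T (u @ [i]) \<longleftrightarrow>
     (\<exists>S. subtree_at u T = Some S \<and> i < length (subtrees S) \<and> subtrees S ! i = Node []
        \<and> length (subtrees S) = 1)"
  unfolding singleton_leaf_def leaf_snoc_iff using siblings_empty_iff by fastforce

lemma elder_leaf_snoc_iff:
  "elder_leaf T (u @ [i]) \<longleftrightarrow>
     (\<exists>S. subtree_at u T = Some S \<and> i < length (subtrees S) \<and> subtrees S ! i = Node []
        \<and> length (subtrees S) \<noteq> 1 \<and> i = 0)"
proof -
  have "leftmost_child T (u @ [i]) \<longleftrightarrow> i = 0" if "leaf T (u @ [i])"
    using that by (auto simp: leftmost_child_def child_def leaf_def)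
  thus ?thesis unfolding elder_leaf_def leaf_snoc_iff using siblings_empty_iff by fastforce
qed

lemma young_leaf_snoc_iff:
  "young_leaf T (u @ [i]) \<longleftrightarrow>
     (\<exists>S. subtree_at u T = Some S \<and> i < length (subtrees S) \<and> subtrees S ! i = Node []
        \<and> length (subtrees S) \<noteq> 1 \<and> i \<noteq> 0)"
proof -
  have "leftmost_child T (u @ [i]) \<longleftrightarrow> i = 0" if "leaf T (u @ [i])"
    using that by (auto simp: leftmost_child_def child_def leaf_def)
  thus ?thesis unfolding young_leaf_def leaf_snoc_iff using siblings_empty_iff by fastforce
qed

text \<open>A singleton or elder leaf is always a first child, and a first child that is a leaf is
  one of the two.\<close>

lemma young_interior_iff:
  "young_interior T v \<longleftrightarrow>
     (\<exists>S. subtree_at v T = Some S \<and> subtrees S \<noteq> [] \<and> subtrees S ! 0 \<noteq> Node [])"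
proof (cases "subtree_at v T")
  case None
  then show ?thesis by (auto simp: young_interior_def interior_vertex_def vertices_def)
next
  case (Some S)
  have "interior_vertex T v \<longleftrightarrow> subtrees S \<noteq> []"
    using Some by (auto simp: interior_vertex_def child_iff vertices_def)
  moreover have "(\<exists>w. child T v w \<and> (singleton_leaf T w \<or> elder_leaf T w)) \<longleftrightarrow> subtrees S ! 0 = Node []"
    if "subtrees S \<noteq> []"
  proof
    assume "\<exists>w. child T v w \<and> (singleton_leaf T w \<or> elder_leaf T w)"
    then show "subtrees S ! 0 = Node []"
      using Some by (auto simp: child_iff singleton_leaf_snoc_iff elder_leaf_snoc_iff)
  next
    assume "subtrees S ! 0 = Node []"
    hence "child T v (v @ [0]) \<and> (singleton_leaf T (v @ [0]) \<or> elder_leaf T (v @ [0]))"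
      using Some that by (auto simp: child_iff singleton_leaf_snoc_iff elder_leaf_snoc_iff)
    thus "\<exists>w. child T v w \<and> (singleton_leaf T w \<or> elder_leaf T w)" by blast
  qed
  ultimately show ?thesis using Some by (auto simp: young_interior_def)
qed

text \<open>The type of a leaf is read off from the child list of its parent, and for
  \<open>p \<noteq> []\<close> this parent lies inside the subtree \<open>ts ! i\<close>.\<close>

lemma vertex_types_Cons:
  assumes "i < length ts" "p \<noteq> []"
  shows "singleton_leaf (Node ts) (i # p) \<longleftrightarrow> singleton_leaf (ts ! i) p"
    and "elder_leaf (Node ts) (i # p) \<longleftrightarrow> elder_leaf (ts ! i) p"
    and "young_leaf (Node ts) (i # p) \<longleftrightarrow> young_leaf (ts ! i) p"
proof -
  obtain q j where "p = q @ [j]" using assms(2) by (cases p rule: rev_cases) auto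
  hence p: "i # p = (i # q) @ [j]" "p = q @ [j]" by auto
  show "singleton_leaf (Node ts) (i # p) \<longleftrightarrow> singleton_leaf (ts ! i) p"
    unfolding p(1) singleton_leaf_snoc_iff using assms(1) by (simp add: p(2) singleton_leaf_snoc_iff)
  show "elder_leaf (Node ts) (i # p) \<longleftrightarrow> elder_leaf (ts ! i) p"
    unfolding p(1) elder_leaf_snoc_iff using assms(1) by (simp add: p(2) elder_leaf_snoc_iff)
  show "young_leaf (Node ts) (i # p) \<longleftrightarrow> young_leaf (ts ! i) p"
    unfolding p(1) young_leaf_snoc_iff using assms(1) by (simp add: p(2) young_leaf_snoc_iff)
qed

text \<open>This property looks only downwards from the vertex, so it also transfers at the root
  \<open>p = []\<close> of the subtree.\<close>

lemma young_interior_Cons: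
  assumes "i < length ts"
  shows "young_interior (Node ts) (i # p) \<longleftrightarrow> young_interior (ts ! i) p"
  using assms by (simp add: young_interior_iff)

section \<open>The weight of a tree\<close>

context
  fixes a b c d t :: "'a::comm_ring_1"
begin

definition tree_weight :: "ptree \<Rightarrow> 'a" where
  "tree_weight T = a ^ sleaf T * b ^ eleaf T * c ^ yleaf T * d ^ yint T * t ^ yedge T"

text \<open>Each young edge is charged to its lower endpoint, which is why the factor
  \<open>t\<close> requires \<open>v \<noteq> []\<close>.\<close>

definition vertex_weight :: "ptree \<Rightarrow> nat list \<Rightarrow> 'a" where
  "vertex_weight T v =
     (if singleton_leaf T v then a else 1) * (if elder_leaf T v then b else 1) *
     (if young_leaf T v then c else 1) * (if young_interior T v then d else 1) *
     (if v \<noteq> [] \<and> \<not> singleton_leaf T v \<and> \<not> elder_leaf T v then t else 1)"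

lemma prod_vertices_if:
  fixes x :: 'a
  assumes "\<And>v. P v \<Longrightarrow> v \<in> vertices T"
  shows "(\<Prod>v\<in>vertices T. if P v then x else 1) = x ^ card {v. P v}"
proof -
  have "{v. P v} = {v \<in> vertices T. P v}" using assms by auto
  thus ?thesis by (simp add: prod.inter_filter[symmetric] finite_vertices)
qed

text \<open>An edge is determined by its lower endpoint, and every vertex other than the root is
  such an endpoint.\<close>

lemma yedge_eq:
  "yedge T = card {v. v \<in> vertices T \<and> v \<noteq> [] \<and> \<not> singleton_leaf T v \<and> \<not> elder_leaf T v}"
proof -
  let ?E = "{(u, v). (u, v) \<in> edges T \<and> \<not> singleton_leaf T v \<and> \<not> elder_leaf T v}"
  have inj: "inj_on snd ?E" by (rule inj_onI) (auto simp: edges_def child_def)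
  have "snd ` ?E = {v. v \<in> vertices T \<and> v \<noteq> [] \<and> \<not> singleton_leaf T v \<and> \<not> elder_leaf T v}"
  proof (rule set_eqI)
    fix v
    show "v \<in> snd ` ?E \<longleftrightarrow> v \<in> {v. v \<in> vertices T \<and> v \<noteq> [] \<and> \<not> singleton_leaf T v \<and> \<not> elder_leaf T v}"
      by (cases v rule: rev_cases) (auto simp: edges_def child_def image_iff)
  qed
  with card_image[OF inj] show ?thesis unfolding yedge_def by simp
qed

lemma tree_weight_eq_prod: "tree_weight T = (\<Prod>v\<in>vertices T. vertex_weight T v)"
proof -
  \<comment> \<open>The negated conditions also hold for addresses outside the tree, so membership
    is added before \<open>prod_vertices_if\<close> applies.\<close>
  have "(\<Prod>v\<in>vertices T. if v \<noteq> [] \<and> \<not> singleton_leaf T v \<and> \<not> elder_leaf T v then t else 1)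
      = (\<Prod>v\<in>vertices T. if v \<in> vertices T \<and> v \<noteq> [] \<and> \<not> singleton_leaf T v \<and> \<not> elder_leaf T v then t else 1)"
    by (rule prod.cong) auto
  also have "\<dots> = t ^ yedge T"
    unfolding yedge_eq by (rule prod_vertices_if) auto
  finally have "(\<Prod>v\<in>vertices T. if v \<noteq> [] \<and> \<not> singleton_leaf T v \<and> \<not> elder_leaf T v then t else 1)
      = t ^ yedge T" .
  moreover have "(\<Prod>v\<in>vertices T. if singleton_leaf T v then a else 1) = a ^ sleaf T"
    unfolding sleaf_def by (rule prod_vertices_if) (auto simp: singleton_leaf_def leaf_def)
  moreover have "(\<Prod>v\<in>vertices T. if elder_leaf T v then b else 1) = b ^ eleaf T"
    unfolding eleaf_def by (rule prod_vertices_if) (auto simp: elder_leaf_def leaf_def)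
  moreover have "(\<Prod>v\<in>vertices T. if young_leaf T v then c else 1) = c ^ yleaf T"
    unfolding yleaf_def by (rule prod_vertices_if) (auto simp: young_leaf_def leaf_def)
  moreover have "(\<Prod>v\<in>vertices T. if young_interior T v then d else 1) = d ^ yint T"
    unfolding yint_def by (rule prod_vertices_if) (auto simp: young_interior_def interior_vertex_def)
  ultimately show ?thesis
    by (simp only: tree_weight_def vertex_weight_def prod.distrib)
qed

lemma vertex_weight_Cons:
  assumes "i < length ts" "p \<noteq> []"
  shows "vertex_weight (Node ts) (i # p) = vertex_weight (ts ! i) p"
  using assms by (simp add: vertex_weight_def vertex_types_Cons young_interior_Cons)

text \<open>The factor of the whole \<open>i\<close>-th subtree together with the edge above it.
  Leaves are separate cases because the single vertex on its own has weight \<open>a\<close>,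
  whatever it becomes as a child.\<close>

definition child_weight :: "ptree list \<Rightarrow> nat \<Rightarrow> 'a" where
  "child_weight ts i =
     (if ts ! i = Node [] then if length ts = 1 then a else if i = 0 then b else t * c
      else t * tree_weight (ts ! i))"

lemma vertex_weight_child:
  assumes "i < length ts"
  shows "vertex_weight (Node ts) [i] =
     (if ts ! i = Node [] then if length ts = 1 then a else if i = 0 then b else t * c
      else t * vertex_weight (ts ! i) [])"
proof -
  have "subtree_at [] (Node ts) = Some (Node ts)" by simp
  thus ?thesis
    using assms singleton_leaf_snoc_iff[of "Node ts" "[]" i] elder_leaf_snoc_iff[of "Node ts" "[]" i]
      young_leaf_snoc_iff[of "Node ts" "[]" i] young_interior_iff[of "ts ! i" "[]"]
    by (simp add: vertex_weight_def young_interior_Cons singleton_leaf_Nil_iff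
          not_elder_leaf_Nil not_young_leaf_Nil)
qed

lemma prod_vertices_child:
  assumes "i < length ts"
  shows "(\<Prod>p\<in>vertices (ts ! i). vertex_weight (Node ts) (i # p)) = child_weight ts i"
proof -
  let ?V = "vertices (ts ! i)"
  have "(\<Prod>p\<in>?V. vertex_weight (Node ts) (i # p)) =
      vertex_weight (Node ts) [i] * (\<Prod>p\<in>?V - {[]}. vertex_weight (Node ts) (i # p))"
    by (rule prod.remove[OF finite_vertices Nil_in_vertices])
  also have "(\<Prod>p\<in>?V - {[]}. vertex_weight (Node ts) (i # p)) =
      (\<Prod>p\<in>?V - {[]}. vertex_weight (ts ! i) p)"
    by (rule prod.cong) (auto simp: vertex_weight_Cons assms)
  also have "vertex_weight (Node ts) [i] * \<dots> = child_weight ts i"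
  proof (cases "ts ! i = Node []")
    case True
    then show ?thesis by (simp add: vertices_Node child_weight_def vertex_weight_child assms)
  next
    case False
    have "tree_weight (ts ! i) =
        vertex_weight (ts ! i) [] * (\<Prod>p\<in>?V - {[]}. vertex_weight (ts ! i) p)"
      unfolding tree_weight_eq_prod by (rule prod.remove[OF finite_vertices Nil_in_vertices])
    with False show ?thesis
      by (simp add: child_weight_def vertex_weight_child assms mult.assoc)
  qed
  finally show ?thesis .
qed

text \<open>The vertices split into the root and the root subtrees. The root is not a leaf and has
  no edge above it, so it contributes at most a factor \<open>d\<close>.\<close>

lemma tree_weight_Node:
  assumes "ts \<noteq> []"
  shows "tree_weight (Node ts) =
    (if ts ! 0 = Node [] then 1 else d) * (\<Prod>i<length ts. child_weight ts i)"
proof -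
  let ?U = "\<Union>i<length ts. (#) i ` vertices (ts ! i)"
  have "tree_weight (Node ts) = vertex_weight (Node ts) [] * (\<Prod>v\<in>?U. vertex_weight (Node ts) v)"
    unfolding tree_weight_eq_prod vertices_Node
    by (rule prod.insert) (auto simp: finite_vertices)
  also have "(\<Prod>v\<in>?U. vertex_weight (Node ts) v) =
      (\<Prod>i<length ts. \<Prod>v\<in>(#) i ` vertices (ts ! i). vertex_weight (Node ts) v)"
    by (rule prod.UNION_disjoint) (auto simp: finite_vertices)
  also have "\<dots> = (\<Prod>i<length ts. child_weight ts i)"
    by (rule prod.cong) (simp_all add: prod.reindex prod_vertices_child)
  also have "vertex_weight (Node ts) [] = (if ts ! 0 = Node [] then 1 else d)"
    using assms by (simp add: vertex_weight_def singleton_leaf_Nil_iff not_elder_leaf_Nil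
        not_young_leaf_Nil young_interior_iff)
  finally show ?thesis .
qed

text \<open>The conventional values are those that make appending a last child multiplicative: a
  lone nonleaf child makes the root young interior, giving \<open>d\<close>, and a lone leaf child
  becomes an elder leaf when a second child arrives, giving \<open>b\<close>.\<close>

definition conv_weight :: "ptree \<Rightarrow> 'a" where
  "conv_weight T =
     (if T = Node [] then d else if T = Node [Node []] then b else tree_weight T)"

text \<open>As a last child, a leaf is young, and a tree with one edge keeps its true weight
  \<open>a\<close> instead of the conventional \<open>b\<close>.\<close>

definition last_weight :: "ptree \<Rightarrow> 'a" where
  "last_weight S =
     t * (if S = Node [] then c else if S = Node [Node []] then a else conv_weight S)"

lemma tree_weight_one_edge: "tree_weight (Node [Node []]) = a"
  by (simp add: tree_weight_Node child_weight_def)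

text \<open>The excluded tree has one edge: its weight is \<open>b\<close>, whereas the product
  would be \<open>d * t * c\<close>.\<close>

lemma conv_weight_snoc:
  assumes "ts \<noteq> [] \<or> S \<noteq> Node []"
  shows "conv_weight (Node (ts @ [S])) = conv_weight (Node ts) * last_weight S"
proof -
  have eq: "conv_weight (Node (ts @ [S])) = tree_weight (Node (ts @ [S]))"
    using assms by (auto simp: conv_weight_def)
  have last: "child_weight (ts @ [S]) (length ts) = last_weight S"
    using assms by (auto simp: child_weight_def last_weight_def conv_weight_def tree_weight_one_edge)
  show ?thesis
  \<comment> \<open>These are the two prefixes whose conventional weight replaces the true
    one.\<close>
  proof (cases "ts = [] \<or> ts = [Node []]")
    case True
    moreover have "child_weight [Node [], S] 0 = b"
      by (simp add: child_weight_def)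
    ultimately show ?thesis
      using assms last unfolding eq by (auto simp: tree_weight_Node conv_weight_def)
  next
    case False
    \<comment> \<open>Appending a child affects an earlier child only if that child was a leaf
      without siblings, which is excluded here.\<close>
    hence "child_weight (ts @ [S]) i = child_weight ts i" if "i < length ts" for i
    proof -
      have "(ts @ [S]) ! i = ts ! i" using that by (simp add: nth_append)
      moreover have "length ts \<noteq> 1 \<or> ts ! i \<noteq> Node []"
        using False that by (cases ts) auto
      moreover have "length (ts @ [S]) \<noteq> 1" using False by simp
      ultimately show ?thesis by (auto simp: child_weight_def)
    qed
    hence "(\<Prod>i<length ts. child_weight (ts @ [S]) i) = (\<Prod>i<length ts. child_weight ts i)"
      by (intro prod.cong) auto
    with False show ?thesis
      unfolding eq
      by (auto simp: tree_weight_Node conv_weight_def last nth_append mult.assoc)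
  qed
qed

section \<open>The functional equation of the generating function\<close>

text \<open>The vertex set is the disjoint union of those of the two parts; the extra edge joins the
  root to \<open>S\<close>.\<close>

lemma card_edges_snoc:
  "card (edges (Node (ts @ [S]))) = Suc (card (edges (Node ts)) + card (edges S))"
proof -
  have U: "(\<Union>i<length (ts @ [S]). (#) i ` vertices ((ts @ [S]) ! i)) =
      (\<Union>i<length ts. (#) i ` vertices (ts ! i)) \<union> (#) (length ts) ` vertices S"
    by (auto simp: nth_append less_Suc_eq lessThan_Suc split: if_splits)
  have "vertices (Node (ts @ [S])) = vertices (Node ts) \<union> (#) (length ts) ` vertices S"
    unfolding vertices_Node U by simp
  moreover have "vertices (Node ts) \<inter> (#) (length ts) ` vertices S = {}"
    by (auto simp: vertices_Node)
  ultimately have "card (vertices (Node (ts @ [S]))) =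
      card (vertices (Node ts)) + card ((#) (length ts) ` vertices S)"
    by (simp add: card_Un_disjoint finite_vertices)
  also have "card ((#) (length ts) ` vertices S) = card (vertices S)"
    by (rule card_image) simp
  finally show ?thesis by (simp add: card_vertices)
qed

lemma card_edges_leaf: "card (edges (Node [])) = 0"
  using card_vertices[of "Node []"] by (simp add: vertices_Node)

lemma plane_trees_0: "plane_trees 0 = {Node []}"
proof -
  have "ts = []" if "card (edges (Node ts)) = 0" for ts
    using that by (cases ts rule: rev_cases) (auto simp: card_edges_snoc)
  hence "T = Node []" if "card (edges T) = 0" for T using that by (cases T) auto
  thus ?thesis by (auto simp: plane_trees_def card_edges_leaf)
qed

lemma card_edges_eq_0_iff: "card (edges T) = 0 \<longleftrightarrow> T = Node []"
  using plane_trees_0 by (auto simp: plane_trees_def)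

text \<open>Detaching the last child of the root is a bijection onto pairs of trees with
  \<open>n\<close> edges in total, one edge being lost.\<close>

lemma sum_plane_trees_Suc:
  fixes f :: "ptree \<Rightarrow> 'a"
  shows "(\<Sum>T\<in>plane_trees (Suc n). f T) =
    (\<Sum>i\<le>n. \<Sum>R\<in>plane_trees i. \<Sum>S\<in>plane_trees (n - i). f (Node (subtrees R @ [S])))"
proof -
  let ?A = "SIGMA i:{..n}. plane_trees i \<times> plane_trees (n - i)"
  have "(\<Sum>T\<in>plane_trees (Suc n). f T) =
      (\<Sum>(i, R, S)\<in>?A. f (Node (subtrees R @ [S])))"
  proof (rule sum.reindex_bij_witness[where
          i = "\<lambda>(i, R, S). Node (subtrees R @ [S])" and
          j = "\<lambda>T. (card (edges (Node (butlast (subtrees T)))), Node (butlast (subtrees T)), last (subtrees T))"])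
    fix T assume T: "T \<in> plane_trees (Suc n)"
    then obtain ts S where "T = Node (ts @ [S])"
      by (cases T; cases "subtrees T" rule: rev_cases) (auto simp: plane_trees_def card_edges_leaf)
    with T show "(case (card (edges (Node (butlast (subtrees T)))), Node (butlast (subtrees T)),
          last (subtrees T)) of (i, R, S) \<Rightarrow> Node (subtrees R @ [S])) = T"
      and "(card (edges (Node (butlast (subtrees T)))), Node (butlast (subtrees T)),
          last (subtrees T)) \<in> ?A"
      and "(case (card (edges (Node (butlast (subtrees T)))), Node (butlast (subtrees T)),
          last (subtrees T)) of (i, R, S) \<Rightarrow> f (Node (subtrees R @ [S]))) = f T"
      by (simp_all add: plane_trees_def card_edges_snoc)
  qed (auto simp: plane_trees_def card_edges_snoc)
  also have "\<dots> = (\<Sum>i\<le>n. \<Sum>(R, S)\<in>plane_trees i \<times> plane_trees (n - i). f (Node (subtrees R @ [S])))"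
    by (subst sum.Sigma) (auto simp: finite_plane_trees)
  also have "\<dots> = (\<Sum>i\<le>n. \<Sum>R\<in>plane_trees i. \<Sum>S\<in>plane_trees (n - i). f (Node (subtrees R @ [S])))"
    by (simp add: sum.cartesian_product)
  finally show ?thesis .
qed

lemma card_edges_one: "card (edges (Node [Node []])) = Suc 0"
  using card_edges_snoc[of "[]" "Node []"] by (simp add: card_edges_leaf)

lemma plane_trees_1: "plane_trees (Suc 0) = {Node [Node []]}"
proof -
  have "T = Node [Node []]" if "card (edges T) = Suc 0" for T
  proof (cases T)
    case (Node ts)
    with that show ?thesis
      by (cases ts rule: rev_cases) (auto simp: card_edges_snoc card_edges_leaf card_edges_eq_0_iff)
  qed
  thus ?thesis by (auto simp: plane_trees_def card_edges_one)
qed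

lemma G_tilde_eq_sum: "G_tilde n a b c d t = (\<Sum>T\<in>plane_trees n. conv_weight T)"
proof -
  consider "n = 0" | "n = Suc 0" | "n \<ge> 2" by linarith
  thus ?thesis
  proof cases
    case 3
    hence "T \<noteq> Node [] \<and> T \<noteq> Node [Node []]" if "T \<in> plane_trees n" for T
      using that by (auto simp: plane_trees_def card_edges_leaf card_edges_one)
    with 3 show ?thesis
      by (auto simp: G_tilde_def conv_weight_def tree_weight_def intro!: sum.cong)
  qed (simp_all add: G_tilde_def conv_weight_def plane_trees_0 plane_trees_1)
qed

text \<open>\<open>last_weight\<close> differs from \<open>t * conv_weight\<close> only on the
  unique trees with zero and one edge, which yields the two corrections.\<close>

lemma sum_last_weight:
  "(\<Sum>S\<in>plane_trees n. last_weight S) =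
     t * (G_tilde n a b c d t + (if n = 0 then c - d else 0) + (if n = Suc 0 then a - b else 0))"
proof -
  consider "n = 0" | "n = Suc 0" | "n \<ge> 2" by linarith
  thus ?thesis
  proof cases
    case 3
    hence "T \<noteq> Node [] \<and> T \<noteq> Node [Node []]" if "T \<in> plane_trees n" for T
      using that by (auto simp: plane_trees_def card_edges_leaf card_edges_one)
    with 3 show ?thesis
      by (auto simp: G_tilde_eq_sum last_weight_def sum_distrib_left intro!: sum.cong)
  qed (simp_all add: G_tilde_def last_weight_def plane_trees_0 plane_trees_1)
qed

text \<open>For \<open>n = 0\<close> the convolution gives \<open>d * t * c\<close> instead of
  \<open>b\<close>; the last summand repairs this.\<close>

lemma G_tilde_Suc:
  "G_tilde (Suc n) a b c d t =
     (\<Sum>i\<le>n. G_tilde i a b c d t *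
        (t * (G_tilde (n - i) a b c d t + (if n - i = 0 then c - d else 0)
                + (if n - i = Suc 0 then a - b else 0))))
     + (if n = 0 then b - d * t * c else 0)"
proof (cases "n = 0")
  case True
  then show ?thesis by (simp add: G_tilde_def algebra_simps)
next
  case False
  have "conv_weight (Node (subtrees R @ [S])) = conv_weight R * last_weight S"
    if "i \<le> n" "R \<in> plane_trees i" "S \<in> plane_trees (n - i)" for i R S
  proof -
    \<comment> \<open>Two single vertices would force \<open>n = 0\<close>.\<close>
    have "R \<noteq> Node [] \<or> S \<noteq> Node []"
      using that False card_edges_leaf by (auto simp: plane_trees_def)
    thus ?thesis using conv_weight_snoc[of "subtrees R" S] by (cases R) auto
  qed
  hence "G_tilde (Suc n) a b c d t =
      (\<Sum>i\<le>n. \<Sum>R\<in>plane_trees i. \<Sum>S\<in>plane_trees (n - i). conv_weight R * last_weight S)"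
    unfolding G_tilde_eq_sum sum_plane_trees_Suc by (intro sum.cong refl) auto
  also have "\<dots> = (\<Sum>i\<le>n. G_tilde i a b c d t * (\<Sum>S\<in>plane_trees (n - i). last_weight S))"
    by (simp add: G_tilde_eq_sum sum_product)
  finally show ?thesis using False by (simp add: sum_last_weight)
qed

lemma fps_G_tilde_equation:
  defines "F \<equiv> Abs_fps (\<lambda>n. G_tilde n a b c d t)"
  shows "F = fps_const d + fps_const (b - d * t * c) * fps_X
    + fps_X * (F * (fps_const t * (F + fps_const (c - d) + fps_const (a - b) * fps_X)))"
proof (rule fps_ext)
  fix n
  show "fps_nth F n = fps_nth (fps_const d + fps_const (b - d * t * c) * fps_X
    + fps_X * (F * (fps_const t * (F + fps_const (c - d) + fps_const (a - b) * fps_X)))) n"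
  proof (cases n)
    case 0
    then show ?thesis by (simp add: F_def G_tilde_def)
  next
    case (Suc m)
    have Y: "fps_nth (fps_const t * (F + fps_const (c - d) + fps_const (a - b) * fps_X)) k =
        t * (G_tilde k a b c d t + (if k = 0 then c - d else 0) + (if k = Suc 0 then a - b else 0))" for k
      by (simp add: F_def fps_X_def)
    have "fps_nth F n = G_tilde (Suc m) a b c d t" by (simp add: Suc F_def)
    also have "\<dots> = fps_nth (F * (fps_const t * (F + fps_const (c - d) + fps_const (a - b) * fps_X))) m
        + (if m = 0 then b - d * t * c else 0)"
      unfolding G_tilde_Suc fps_mult_nth[of F] Y by (simp add: F_def atLeast0AtMost)
    finally show ?thesis by (simp add: Suc fps_nth_fps_const)
  qed
qed

end

section \<open>Solving the quadratic equation for the generating function\<close>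

theorem theorem3p2:
  fixes a b c d t :: "'a::field_char_0"
  assumes "t \<noteq> 0"
  shows "Abs_fps (\<lambda>n. G_tilde n a b c d t) =
    (fps_const (inverse t) + fps_const (d - c) * fps_X + fps_const (b - a) * fps_X ^ 2
      - fps_sqrt_with (inverse t)
          (fps_const (inverse t ^ 2)
           - fps_const (2 * inverse t * (c + d)) * fps_X
           + fps_const ((c + d) ^ 2 - 2 * inverse t * (a + b)) * fps_X ^ 2
           + fps_const (2 * (a - b) * (c - d)) * fps_X ^ 3
           + fps_const ((a - b) ^ 2) * fps_X ^ 4))
    / (2 * fps_X)"
proof -
  define F where "F = Abs_fps (\<lambda>n. G_tilde n a b c d t)"
  define P where "P = fps_const (inverse t) + fps_const (d - c) * fps_X + fps_const (b - a) * fps_X ^ 2"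
  define D where "D = fps_const (inverse t ^ 2)
           - fps_const (2 * inverse t * (c + d)) * fps_X
           + fps_const ((c + d) ^ 2 - 2 * inverse t * (a + b)) * fps_X ^ 2
           + fps_const (2 * (a - b) * (c - d)) * fps_X ^ 3
           + fps_const ((a - b) ^ 2) * fps_X ^ 4"
  \<comment> \<open>Naming the constant series keeps them atomic for the ring calculations
    below.\<close>
  define A B C E s where "A = fps_const a" and "B = fps_const b" and "C = fps_const c"
    and "E = fps_const d" and "s = fps_const (inverse t)"
  note const_defs = A_def B_def C_def E_def s_def
  let ?q = "fps_X :: 'a fps"
  \<comment> \<open>Multiplying the functional equation by \<open>s\<close> cancels every
    \<open>t\<close> and leaves \<open>eq\<close>, which is quadratic in \<open>F\<close> with
    leading coefficient \<open>?q\<close>.\<close>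
  have ts: "s * fps_const t = 1" using assms by (simp add: s_def)
  have "F = E + (B - E * fps_const t * C) * ?q + ?q * (F * (fps_const t * (F + (C - E) + (A - B) * ?q)))"
    using fps_G_tilde_equation[of a b c d t] by (simp add: F_def const_defs)
  hence "s * F = s * E + s * (B - E * fps_const t * C) * ?q
      + s * (?q * (F * (fps_const t * (F + (C - E) + (A - B) * ?q))))"
    by (metis distrib_left mult.assoc)
  also have "\<dots> = s * E + (s * B - (s * fps_const t) * E * C) * ?q
      + ?q * F * (s * fps_const t) * (F + (C - E) + (A - B) * ?q)"
    by algebra
  finally have eq: "s * F = s * E + (s * B - E * C) * ?q + ?q * F * (F + (C - E) + (A - B) * ?q)"
    by (simp add: ts)
  have P: "P = s + (E - C) * ?q + (B - A) * ?q ^ 2"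
    by (simp add: P_def const_defs)
  have two: "fps_const 2 = (2 :: 'a fps)" by (simp add: numeral_fps_const)
  have D: "D = s ^ 2 - 2 * s * (C + E) * ?q + ((C + E) ^ 2 - 2 * s * (A + B)) * ?q ^ 2
      + 2 * (A - B) * (C - E) * ?q ^ 3 + (A - B) ^ 2 * ?q ^ 4"
    by (simp add: D_def const_defs fps_const_mult[symmetric] fps_const_power[symmetric]
        fps_const_add[symmetric] fps_const_sub[symmetric] two
        del: fps_const_mult fps_const_power fps_const_add fps_const_sub)
  have sq: "(P - 2 * ?q * F) ^ 2 = D"
  proof -
    \<comment> \<open>Completing the square: the difference is \<open>4 * ?q\<close> times the right
      side minus the left side of \<open>eq\<close>.\<close>
    have "(P - 2 * ?q * F) ^ 2 - D =
        4 * ?q * (s * E + (s * B - E * C) * ?q + ?q * F * (F + (C - E) + (A - B) * ?q) - s * F)"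
      unfolding P D by (simp add: algebra_simps power2_eq_square power3_eq_cube power4_eq_xxxx)
    thus ?thesis using eq by simp
  qed
  have nz: "inverse t \<noteq> 0" using assms by simp
  have D0: "fps_nth D 0 = inverse t ^ 2"
    by (simp add: D_def)
  have P0: "fps_nth (P - 2 * ?q * F) 0 = inverse t"
    by (simp add: P_def)
  \<comment> \<open>The constant term singles out this root among the two of opposite sign.\<close>
  have "fps_sqrt_with (inverse t) D = P - 2 * ?q * F"
    using fps_sqrt_with_ex1[OF nz D0] fps_sqrt_with[OF nz D0] sq P0 by blast
  \<comment> \<open>The numerator is a multiple of \<open>2 * ?q\<close>, so the power series
    division is exact.\<close>
  hence "(P - fps_sqrt_with (inverse t) D) / (2 * ?q) = (2 * ?q) * F / (2 * ?q)"
    by simp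
  also have "\<dots> = F"
    by (rule nonzero_mult_div_cancel_left) simp
  finally show ?thesis by (simp add: F_def P_def D_def)
qed

end
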